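(* Let $n$ be an odd positive integer, let $G=\mathrm{SO}(n+1)$, let $(V_\tau,\tau)$ be a unitary irreducible (finite dimensional, complex) representation of $G$, and let $(V_\pi,\pi)$ be a unitary irreducible representation of $\mathrm{SO}(n)$ which is a sub-representation of $\tau_{|\mathrm{SO}(n)}$. Let $-I$ denote minus the identity matrix in $G$. If $\Phi^{\tau,\pi}(-I)=I$, take $\gamma=\pi\otimes 1$; if $\Phi^{\tau,\pi}(-I)=-I$, take $\gamma=\pi\otimes\epsilon$. Then $\Phi^{\tau,\pi}(g)=\Phi^{\tau,\gamma}(g)$ for all $g\in G$.
   Context: Embeddings: $\mathrm{O}(n)$ is regarded as a subgroup of $G=\mathrm{SO}(n+1)$ via $k\mapsto \begin{pmatrix} k&0\\0&\det k\end{pmatrix}$; restricting gives $\mathrm{SO}(n)\subset G$. For $n$ odd put $a=-I_n\in\mathrm{O}(n)$ (which becomes $-I\in G$) and $F=\{1,a\}$. Then $\mathrm{O}(n)=\mathrm{SO}(n)\times F$. Let $1$ be the trivial character of $F$ and $\epsilon$ the nontrivial one ($\epsilon(a)=-1$). For a representation $\pi$ of $\mathrm{SO}(n)$ on $V_\pi$, $\pi\otimes 1$ and $\pi\otimes\epsilon$ are the representations of $\mathrm{O}(n)$ on $V_\pi$ given by $kx\mapsto \pi(k)$ and $kx\mapsto\epsilon(x)\pi(k)$ ($k\in\mathrm{SO}(n)$, $x\in F$). Since $-I$ is central in $G$ when $n$ is odd and $(-I)^2=I$, one has $\tau(-I)=\pm I$, so exactly one of the two cases in the claim occurs. Spherical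 functions: let $K$ be a compact subgroup of $G$ with Haar measure $dk$ normalized by $\int_K dk=1$, and let $\delta$ be an irreducible finite dimensional complex representation of $K$ with degree $d(\delta)$, character $\xi_\delta$, and $\chi_\delta=d(\delta)\xi_\delta$. Let $P_\delta=\int_K\chi_\delta(k^{-1})\tau(k)\,dk$ be the projection of $V_\tau$ onto its $\delta$-isotypic subspace $V_\tau(\delta)=P_\delta V_\tau$. The spherical function of type $\delta$ associated with $\tau$ is $\Phi^{\tau,\delta}:G\to\mathrm{End}(V_\tau(\delta))$, $\Phi^{\tau,\delta}(g)v=P_\delta\tau(g)v$ for $v\in V_\tau(\delta)$. Here $\Phi^{\tau,\pi}$ is taken with $K=\mathrm{SO}(n)$ and $\Phi^{\tau,\gamma}$ with $K=\mathrm{O}(n)$. Each irreducible representation of $\mathrm{SO}(n)$ occurs in $\tau_{|\mathrm{SO}(n)}$ with multiplicity at most one, so $V_\tau(\pi)$ is identified with $V_\pi$. The equality $\Phi^{\tau,\pi}=\Phi^{\tau,\gamma}$ is an equality of functions with values in the endomorphisms of the same subspace of $V_\tau$ (so it includes $V_\tau(\gamma)=V_\tau(\pi)$). *)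

theory Defs
  imports "HOL-Probability.Probability"
begin

section \<open>Finite dimensional complex inner product spaces\<close>

text \<open>
  The real inner product, topology and integration theory come from \<^class>\<open>euclidean_space\<close>;
  the Hermitian form is linear in its first argument and has the real inner product as its
  real part. A type of this class is nonzero because \<^class>\<open>euclidean_space\<close> requires a
  nonempty basis.
\<close>

class hermitian_space = euclidean_space +
  fixes scaleC :: "complex \<Rightarrow> 'a \<Rightarrow> 'a" (infixr \<open>*\<^sub>C\<close> 75)
    and cinner :: "'a \<Rightarrow> 'a \<Rightarrow> complex"
  assumes scaleC_add_right: "c *\<^sub>C (x + y) = c *\<^sub>C x + c *\<^sub>C y"
    and scaleC_add_left: "(c + d) *\<^sub>C x = c *\<^sub>C x + d *\<^sub>C x"
    and scaleC_scaleC: "c *\<^sub>C (d *\<^sub>C x) = (c * d) *\<^sub>C x"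
    and scaleC_of_real: "complex_of_real r *\<^sub>C x = r *\<^sub>R x"
    and cinner_add_left: "cinner (x + y) z = cinner x z + cinner y z"
    and cinner_scaleC_left: "cinner (c *\<^sub>C x) y = c * cinner x y"
    and cinner_commute: "cinner y x = cnj (cinner x y)"
    and Re_cinner: "Re (cinner x y) = x \<bullet> y"

lemma scaleC_one: "1 *\<^sub>C (x :: 'a :: hermitian_space) = x"
  using scaleC_of_real[of 1 x] by simp

global_interpretation cvec: vector_space "scaleC :: complex \<Rightarrow> 'a \<Rightarrow> 'a :: hermitian_space"
  defines csubspace = cvec.subspace
    and cspan = cvec.span
    and cdependent = cvec.dependent
    and cdim = cvec.dim
    and crepresentation = cvec.representation
  by unfold_locales
    (simp_all add: scaleC_add_right scaleC_add_left scaleC_scaleC scaleC_one)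

abbreviation clinear :: "('a :: hermitian_space \<Rightarrow> 'b :: hermitian_space) \<Rightarrow> bool"
  where "clinear \<equiv> Vector_Spaces.linear scaleC scaleC"

instantiation complex :: hermitian_space
begin

definition "c *\<^sub>C (z :: complex) = c * z"
definition "cinner (z :: complex) w = z * cnj w"

instance
  by standard
    (simp_all add: scaleC_complex_def cinner_complex_def algebra_simps scaleR_conv_of_real
      inner_complex_def)

end

instantiation vec :: (hermitian_space, finite) hermitian_space
begin

definition "c *\<^sub>C (x :: 'a ^ 'b) = (\<chi> i. c *\<^sub>C (x $ i))"
definition "cinner (x :: 'a ^ 'b) y = (\<Sum>i\<in>UNIV. cinner (x $ i) (y $ i))"

instance
proof
  fix x y z :: "'a ^ 'b" and c d :: complex and r :: real
  show "c *\<^sub>C (x + y) = c *\<^sub>C x + c *\<^sub>C y" "(c + d) *\<^sub>C x = c *\<^sub>C x + d *\<^sub>C x"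
    "c *\<^sub>C (d *\<^sub>C x) = (c * d) *\<^sub>C x" "complex_of_real r *\<^sub>C x = r *\<^sub>R x"
    by (simp_all add: scaleC_vec_def vec_eq_iff scaleC_add_right scaleC_add_left scaleC_scaleC
        scaleC_of_real)
  show "cinner (x + y) z = cinner x z + cinner y z" "cinner (c *\<^sub>C x) y = c * cinner x y"
    by (simp_all add: cinner_vec_def scaleC_vec_def cinner_add_left cinner_scaleC_left
        sum.distrib sum_distrib_left)
  show "cinner y x = cnj (cinner x y)"
    unfolding cinner_vec_def cnj_sum by (intro sum.cong refl cinner_commute)
  show "Re (cinner x y) = x \<bullet> y"
    by (simp add: cinner_vec_def inner_vec_def Re_cinner)
qed

end

text \<open>
  Trace of the matrix of an endomorphism with respect to a complex basis; the value does not
  depend on the basis chosen.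
\<close>

definition ctrace :: "('v :: hermitian_space \<Rightarrow> 'v) \<Rightarrow> complex" where
  "ctrace f = (let B = SOME B. \<not> cdependent B \<and> cspan B = (UNIV :: 'v set)
               in \<Sum>b\<in>B. crepresentation B (f b) b)"


section \<open>The groups\<close>

definition O_group :: "(real ^ 'n ^ 'n) set" where
  "O_group = {A. orthogonal_matrix A}"

definition SO_group :: "(real ^ 'n ^ 'n) set" where
  "SO_group = {A. orthogonal_matrix A \<and> det A = 1}"

text \<open>
  \<^term>\<open>CARD('n option) = CARD('n) + 1\<close>, so matrices over \<^typ>\<open>'n option\<close> are the
  \<open>(n+1) \<times> (n+1)\<close> matrices, \<^term>\<open>None\<close> being the last index.
\<close>

definition emb :: "real ^ 'n ^ 'n \<Rightarrow> real ^ ('n option) ^ ('n option)" where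
  "emb k = (\<chi> i j. case (i, j) of
       (Some i', Some j') \<Rightarrow> k $ i' $ j'
     | (None, None) \<Rightarrow> det k
     | _ \<Rightarrow> 0)"

definition F_group :: "(real ^ 'n ^ 'n) set" where
  "F_group = {mat 1, - mat 1}"

definition triv_char :: "real ^ 'n ^ 'n \<Rightarrow> complex" where
  "triv_char x = 1"

definition eps_char :: "real ^ 'n ^ 'n \<Rightarrow> complex" where
  "eps_char x = (if x = - mat 1 then -1 else 1)"

text \<open>
  A Haar measure on a compact matrix group \<open>K\<close> with total mass 1: a left invariant Borel
  probability measure on \<open>K\<close>. By uniqueness of Haar measure at most one such measure exists.
\<close>

definition normalized_haar :: "(real ^ 'n ^ 'n) set \<Rightarrow> (real ^ 'n ^ 'n) measure \<Rightarrow> bool" where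
  "normalized_haar K \<mu> \<longleftrightarrow>
     prob_space \<mu> \<and> sets \<mu> = sets (restrict_space borel K) \<and>
     (\<forall>k\<in>K. distr \<mu> \<mu> (\<lambda>x. k ** x) = \<mu>)"


section \<open>Representations\<close>

text \<open>Representations are functions on all matrices; only their values on \<open>K\<close> matter.\<close>

definition unitary_rep ::
  "(real ^ 'n ^ 'n) set \<Rightarrow> (real ^ 'n ^ 'n \<Rightarrow> 'v :: hermitian_space \<Rightarrow> 'v) \<Rightarrow> bool" where
  "unitary_rep K \<tau> \<longleftrightarrow>
     (\<forall>g\<in>K. clinear (\<tau> g)) \<and>
     (\<forall>g\<in>K. \<forall>v w. cinner (\<tau> g v) (\<tau> g w) = cinner v w) \<and>
     \<tau> (mat 1) = id \<and>
     (\<forall>g\<in>K. \<forall>h\<in>K. \<tau> (g ** h) = \<tau> g \<circ> \<tau> h) \<and>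
     (\<forall>v. continuous_on K (\<lambda>g. \<tau> g v))"

definition irreducible_rep ::
  "(real ^ 'n ^ 'n) set \<Rightarrow> (real ^ 'n ^ 'n \<Rightarrow> 'v :: hermitian_space \<Rightarrow> 'v) \<Rightarrow> bool" where
  "irreducible_rep K \<tau> \<longleftrightarrow>
     (\<forall>W. csubspace W \<and> (\<forall>g\<in>K. \<tau> g ` W \<subseteq> W) \<longrightarrow> W = {0} \<or> W = UNIV)"

text \<open>\<open>\<pi>\<close> is (equivalent to) a sub-representation of the restriction of \<open>\<tau>\<close> to \<open>K\<close>,
  where \<open>K\<close> is viewed as a subgroup of the larger group through \<^const>\<open>emb\<close>.\<close>

definition is_subrep ::
  "(real ^ 'n ^ 'n) set \<Rightarrow> (real ^ 'n ^ 'n \<Rightarrow> 'w :: hermitian_space \<Rightarrow> 'w) \<Rightarrow>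
   (real ^ ('n option) ^ ('n option) \<Rightarrow> 'v :: hermitian_space \<Rightarrow> 'v) \<Rightarrow> bool" where
  "is_subrep K \<pi> \<tau> \<longleftrightarrow>
     (\<exists>T. clinear T \<and> inj T \<and> (\<forall>k\<in>K. \<forall>w. T (\<pi> k w) = \<tau> (emb k) (T w)))"

text \<open>
  The representation \<open>k x \<mapsto> \<psi>(x) \<pi>(k)\<close> of \<open>O(n)\<close>, for \<open>k\<close> in \<open>SO(n)\<close> and \<open>x\<close> in \<open>F\<close>.
  It is meaningful only for odd \<open>n\<close>, when this decomposition exists and is unique.
\<close>

definition tensor_char ::
  "(real ^ 'n ^ 'n \<Rightarrow> 'w :: hermitian_space \<Rightarrow> 'w) \<Rightarrow> (real ^ 'n ^ 'n \<Rightarrow> complex) \<Rightarrow>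
   real ^ 'n ^ 'n \<Rightarrow> 'w \<Rightarrow> 'w" where
  "tensor_char \<pi> \<psi> h =
     (case (THE (k, x). k \<in> SO_group \<and> x \<in> F_group \<and> h = k ** x) of
        (k, x) \<Rightarrow> (\<lambda>v. \<psi> x *\<^sub>C \<pi> k v))"


section \<open>Spherical functions\<close>

definition chi ::
  "(real ^ 'n ^ 'n \<Rightarrow> 'w :: hermitian_space \<Rightarrow> 'w) \<Rightarrow> real ^ 'n ^ 'n \<Rightarrow> complex" where
  "chi \<delta> k = of_nat (cdim (UNIV :: 'w set)) * ctrace (\<delta> k)"

text \<open>In what follows \<open>\<mu>\<close> is the normalized Haar measure of the compact group \<open>K\<close>.\<close>

definition isotypic_proj ::
  "(real ^ 'n ^ 'n) measure \<Rightarrow>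
   (real ^ ('n option) ^ ('n option) \<Rightarrow> 'v :: hermitian_space \<Rightarrow> 'v) \<Rightarrow>
   (real ^ 'n ^ 'n \<Rightarrow> 'w :: hermitian_space \<Rightarrow> 'w) \<Rightarrow> 'v \<Rightarrow> 'v" where
  "isotypic_proj \<mu> \<tau> \<delta> v = (LINT k|\<mu>. chi \<delta> (matrix_inv k) *\<^sub>C \<tau> (emb k) v)"

definition isotypic ::
  "(real ^ 'n ^ 'n) measure \<Rightarrow>
   (real ^ ('n option) ^ ('n option) \<Rightarrow> 'v :: hermitian_space \<Rightarrow> 'v) \<Rightarrow>
   (real ^ 'n ^ 'n \<Rightarrow> 'w :: hermitian_space \<Rightarrow> 'w) \<Rightarrow> 'v set" where
  "isotypic \<mu> \<tau> \<delta> = range (isotypic_proj \<mu> \<tau> \<delta>)"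

definition spherical_function ::
  "(real ^ 'n ^ 'n) measure \<Rightarrow>
   (real ^ ('n option) ^ ('n option) \<Rightarrow> 'v :: hermitian_space \<Rightarrow> 'v) \<Rightarrow>
   (real ^ 'n ^ 'n \<Rightarrow> 'w :: hermitian_space \<Rightarrow> 'w) \<Rightarrow>
   real ^ ('n option) ^ ('n option) \<Rightarrow> 'v \<Rightarrow> 'v" where
  "spherical_function \<mu> \<tau> \<delta> g = (\<lambda>v\<in>isotypic \<mu> \<tau> \<delta>. isotypic_proj \<mu> \<tau> \<delta> (\<tau> g v))"

text \<open>Equality as functions on \<open>SO(n+1)\<close> with values in the endomorphisms of one and the same
  subspace.\<close>

definition same_spherical_function ::
  "(real ^ 'n ^ 'n) measure \<Rightarrow> (real ^ 'n ^ 'n) measure \<Rightarrow>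
   (real ^ ('n option) ^ ('n option) \<Rightarrow> 'v :: hermitian_space \<Rightarrow> 'v) \<Rightarrow>
   (real ^ 'n ^ 'n \<Rightarrow> 'w :: hermitian_space \<Rightarrow> 'w) \<Rightarrow>
   (real ^ 'n ^ 'n \<Rightarrow> 'w \<Rightarrow> 'w) \<Rightarrow> bool" where
  "same_spherical_function \<mu> \<nu> \<tau> \<delta> \<gamma> \<longleftrightarrow>
     isotypic \<mu> \<tau> \<delta> = isotypic \<nu> \<tau> \<gamma> \<and>
     (\<forall>g\<in>SO_group. spherical_function \<mu> \<tau> \<delta> g = spherical_function \<nu> \<tau> \<gamma> g)"

end

theory Submission
  imports Defs
begin

text \<open>
  Let \<open>P\<close> and \<open>P\<^sub>\<gamma>\<close> be the isotypic projections for \<open>\<pi>\<close> and for \<open>\<gamma> = \<pi> \<otimes> \<psi>\<close>, and put \<open>s = \<psi>(- 1)\<close>.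
  A spherical function depends on the representation of the subgroup only through its projection, so
  the point is that \<open>P\<^sub>\<gamma> = P\<close>.

  Since \<open>O(n)\<close> consists of the two cosets \<open>SO(n)\<close> and \<open>- SO(n)\<close>, which have equal mass, the integral
  defining \<open>P\<^sub>\<gamma>\<close> is a mean of two integrals over \<open>SO(n)\<close>, and \<open>P\<^sub>\<gamma> v = (P v + s P (\<tau>(- I) v)) / 2\<close>
  (\<open>isotypic_proj_tensor_char\<close>). That the two given Haar measures are related in this way rests on the
  uniqueness of Haar measure (\<open>haar_unique\<close>), a Fubini argument. As \<open>- I\<close> is a central involution,
  Schur's lemma gives \<open>\<tau>(- I) = \<sigma>\<close> with \<open>\<sigma> = 1\<close> or \<open>\<sigma> = - 1\<close> (\<open>central_involution_scalar\<close>). Hence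
  \<open>P\<^sub>\<gamma> = (1 + s \<sigma>) / 2 \<cdot> P\<close>, which is \<open>P\<close> as soon as \<open>\<sigma> = s\<close>.

  The hypothesis \<open>\<Phi>(- I) = s\<close> on the isotypic subspace says \<open>\<sigma> P\<^sup>2 = s P\<close>. If \<open>\<sigma> \<noteq> s\<close>, this is
  \<open>P\<^sup>2 = - P\<close>, and a trace computation on the space of \<open>\<pi>\<close>, embedded in that of \<open>\<tau>\<close>, then forces \<open>P = 0\<close>
  (\<open>isotypic_proj_zero_if_square_eq_uminus\<close>): the trace of an idempotent is nonnegative, whereas
  the sign in \<open>P\<^sup>2 = - P\<close> would make it \<open>- d(\<pi>) \<integral> |\<xi>\<^sub>\<pi>|\<^sup>2\<close>. With \<open>P = 0\<close> also \<open>P\<^sub>\<gamma> = 0\<close>.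
\<close>

section \<open>Traces of complex linear maps\<close>

lemma clinear_add: "clinear f \<Longrightarrow> f (x + y) = f x + f y"
  by (simp add: Vector_Spaces.linear_iff)

lemma clinear_scaleC: "clinear f \<Longrightarrow> f (c *\<^sub>C x) = c *\<^sub>C f x"
  by (simp add: Vector_Spaces.linear_iff)

lemma clinearI:
  assumes "\<And>x y. f (x + y) = f x + f y" "\<And>c x. f (c *\<^sub>C x) = c *\<^sub>C f x"
  shows "clinear f"
  by unfold_locales (use assms in \<open>simp_all add: scaleC_add_right scaleC_add_left scaleC_scaleC scaleC_one\<close>)

lemma clinear_bounded_linear: "clinear f \<Longrightarrow> bounded_linear f"
  unfolding linear_conv_bounded_linear[symmetric]
  by (rule linearI) (simp_all add: clinear_add clinear_scaleC flip: scaleC_of_real)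

lemma clinear_minus: "clinear f \<Longrightarrow> f (- x) = - f x"
  by (simp add: linear_neg[OF bounded_linear.linear] clinear_bounded_linear)

lemma clinear_scaleC_right: "clinear (\<lambda>x. c *\<^sub>C x)"
  by (rule clinearI) (simp_all add: scaleC_add_right scaleC_scaleC mult.commute)

lemma scaleC_minus_one: "(- 1) *\<^sub>C x = - x"
  using scaleC_of_real[of "-1" x] by simp

lemma bounded_bilinear_scaleC:
  "bounded_bilinear (\<lambda>c (x::'a::hermitian_space). c *\<^sub>C x)"
  unfolding bilinear_conv_bounded_bilinear[symmetric] bilinear_def
  by (auto intro!: linearI simp: scaleC_add_left scaleC_add_right scaleC_scaleC mult.commute
      scaleR_conv_of_real simp flip: scaleC_of_real)

lemma bounded_linear_cinner_left: "bounded_linear (\<lambda>x. cinner x y)"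
  unfolding linear_conv_bounded_linear[symmetric]
  by (rule linearI)
    (simp_all add: cinner_add_left cinner_scaleC_left scaleR_conv_of_real flip: scaleC_of_real)

text \<open>
  The Hermitian form is determined by the real inner product and multiplication by \<open>\<i>\<close>, so
  real orthonormal bases suffice for complex traces.
\<close>

lemma cinner_eq_Complex: "cinner x y = complex_of_real (x \<bullet> y) - \<i> * complex_of_real ((\<i> *\<^sub>C x) \<bullet> y)"
  by (rule complex_eqI) (simp_all add: Re_cinner[symmetric] cinner_scaleC_left)

text \<open>
  A complex independent set is real independent, and the real dimension is finite. Finiteness
  matters because a sum over an infinite basis would be 0 by convention.
\<close>

lemma cindependent_imp_finite:
  fixes B :: "'a::hermitian_space set"
  assumes "\<not> cdependent B" shows "finite B"
proof -
  have "independent B"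
  proof (rule ccontr)
    assume "\<not> independent B"
    then obtain S u v where S: "finite S" "S \<subseteq> B" "(\<Sum>b\<in>S. u b *\<^sub>R b) = 0" "v \<in> S" "u v \<noteq> 0"
      unfolding real_vector.dependent_explicit by auto
    then have "(\<Sum>b\<in>S. complex_of_real (u b) *\<^sub>C b) = 0"
      by (simp add: scaleC_of_real)
    then have "complex_of_real (u v) = 0"
      by (rule cvec.independentD[OF assms S(1,2) _ S(4)])
    then show False using S(5) by simp
  qed
  then show ?thesis by (rule independent_imp_finite)
qed

text \<open>
  Expand \<open>\<phi> x\<close> and \<open>- \<i> * \<phi> (\<i> x) = \<phi> x\<close> along the real orthonormal basis and add: the coefficients
  \<open>x \<bullet> b\<close> and \<open>- \<i> ((\<i> x) \<bullet> b)\<close> combine to \<open>cinner x b\<close>. The factor 2 is the degree of the complex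
  numbers over the reals.
\<close>

lemma clinear_functional_eq_sum_Basis:
  fixes \<phi> :: "'a::hermitian_space \<Rightarrow> complex"
  assumes "clinear \<phi>"
  shows "(\<Sum>b\<in>Basis. \<phi> b * cinner x b) = 2 * \<phi> x"
proof -
  have lin: "linear \<phi>" using assms clinear_bounded_linear bounded_linear.linear by blast
  have ex: "\<phi> y = (\<Sum>b\<in>Basis. complex_of_real (y \<bullet> b) * \<phi> b)" for y
    by (subst euclidean_representation[of y, symmetric])
      (simp only: linear_sum[OF lin] linear_scale[OF lin] scaleR_conv_of_real)
  have "(\<Sum>b\<in>Basis. \<phi> b * cinner x b) = \<phi> x - \<i> * \<phi> (\<i> *\<^sub>C x)"
    by (simp add: cinner_eq_Complex ex[of x] ex[of "\<i> *\<^sub>C x"] sum_distrib_left sum_subtractf algebra_simps)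
  also have "\<phi> (\<i> *\<^sub>C x) = \<i> * \<phi> x"
    using clinear_scaleC[OF assms] by (simp add: scaleC_complex_def)
  finally show ?thesis by simp
qed

text \<open>
  The right-hand side does not mention \<open>B\<close>, so this gives at once the independence of the trace from
  the complex basis and a formula in which adjoints and integrals are easy to handle. Each coefficient
  \<open>v \<mapsto> crepresentation B (f v) c\<close> is a complex linear functional, to which the preceding lemma applies.
\<close>

lemma trace_eq_sum_cinner_Basis:
  fixes f :: "'a::hermitian_space \<Rightarrow> 'a"
  assumes f: "clinear f" and B: "\<not> cdependent B" "cspan B = UNIV"
  shows "(\<Sum>b\<in>B. crepresentation B (f b) b) = (\<Sum>b\<in>Basis. cinner (f b) b) / 2"
proof -
  have fin: "finite B" using B cindependent_imp_finite by blast
  have lin: "clinear (\<lambda>v. crepresentation B (f v) c)" for c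
    by (rule clinearI) (simp_all add: B clinear_add[OF f] clinear_scaleC[OF f]
        cvec.representation_add cvec.representation_scale scaleC_complex_def)
  have "cinner (f b) b = (\<Sum>c\<in>B. crepresentation B (f b) c * cinner c b)" for b
    by (subst cvec.sum_representation_eq[OF B(1) _ fin order_refl, of "f b", symmetric])
      (simp_all add: B(2) linear_sum[OF bounded_linear.linear[OF bounded_linear_cinner_left]] cinner_scaleC_left)
  then have "(\<Sum>b\<in>Basis. cinner (f b) b)
      = (\<Sum>c\<in>B. \<Sum>b\<in>Basis. crepresentation B (f b) c * cinner c b)"
    by (simp add: sum.swap[of _ _ B])
  also have "\<dots> = (\<Sum>c\<in>B. 2 * crepresentation B (f c) c)"
    by (simp add: clinear_functional_eq_sum_Basis[OF lin])
  finally show ?thesis by (simp add: sum_distrib_left[symmetric])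
qed

lemma ctrace_eq_sum_cinner_Basis:
  fixes f :: "'a::hermitian_space \<Rightarrow> 'a"
  assumes f: "clinear f"
  shows "ctrace f = (\<Sum>b\<in>Basis. cinner (f b) b) / 2"
proof -
  define B where "B = (SOME B :: 'a set. \<not> cdependent B \<and> cspan B = UNIV)"
  have "\<exists>B::'a set. \<not> cdependent B \<and> cspan B = UNIV"
    using cvec.basis_exists[of UNIV] by (metis top.extremum_uniqueI)
  then have "\<not> cdependent B \<and> cspan B = UNIV"
    unfolding B_def by (rule someI_ex)
  then show ?thesis
    unfolding ctrace_def Let_def B_def[symmetric] using trace_eq_sum_cinner_Basis[OF f] by blast
qed

text \<open>
  The trace of an idempotent is its rank: in a basis that extends a basis \<open>C\<close> of the range, the elements
  of \<open>C\<close> are fixed and contribute 1 each, while the other basis vectors are mapped into the span of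
  \<open>C\<close> and contribute 0.
\<close>

lemma trace_idempotent_nonneg:
  fixes Q :: "'a::hermitian_space \<Rightarrow> 'a"
  assumes Q: "clinear Q" and idem: "\<And>x. Q (Q x) = Q x"
  shows "0 \<le> (\<Sum>b\<in>Basis. Q b \<bullet> b)"
proof -
  obtain C where C: "C \<subseteq> range Q" "\<not> cdependent C" "range Q \<subseteq> cspan C"
    by (rule cvec.basis_exists[of "range Q"])
  obtain B where B: "C \<subseteq> B" "\<not> cdependent B" "UNIV \<subseteq> cspan B"
    using cvec.maximal_independent_subset_extend[of C UNIV] C(2) by auto
  have "0 \<le> Re (crepresentation B (Q b) b)" if "b \<in> B" for b
  proof (cases "b \<in> C")
    case True
    then have "Q b = b" using C(1) idem by auto
    then show ?thesis using B that by (simp add: cvec.representation_basis)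
  next
    case False
    have "crepresentation B (Q b) b = crepresentation C (Q b) b"
      using C B by (subst cvec.representation_extend[of B _ C]) auto
    also have "\<dots> = 0" using False cvec.representation_ne_zero by blast
    finally show ?thesis by simp
  qed
  then have "0 \<le> Re (\<Sum>b\<in>B. crepresentation B (Q b) b)"
    by (simp add: sum_nonneg)
  also have "\<dots> = (\<Sum>b\<in>Basis. Q b \<bullet> b) / 2"
    using B by (subst trace_eq_sum_cinner_Basis[OF Q]) (auto simp: Re_cinner)
  finally show ?thesis by simp
qed

section \<open>Orthogonal matrices and the embedding of \<open>O(n)\<close> into \<open>SO(n+1)\<close>\<close>

lemma det_uminus:
  fixes A :: "real ^ 'n ^ 'n"
  shows "det (- A) = (- 1) ^ CARD('n) * det A"
proof -
  have "- A = (\<chi> i. (- 1) *s A $ i)" by (simp add: vec_eq_iff)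
  then show ?thesis using det_rows_mul[of "\<lambda>_. - 1" "\<lambda>i. A $ i"] by simp
qed

lemma matrix_mul_uminus_left: "(- A) ** B = - (A ** (B :: real ^ 'n ^ 'm))"
  by (simp add: vec_eq_iff matrix_matrix_mult_def sum_negf)

lemma matrix_mul_uminus_right: "A ** (- B) = - (A ** (B :: real ^ 'n ^ 'm))"
  by (simp add: vec_eq_iff matrix_matrix_mult_def sum_negf)

lemma transpose_uminus: "transpose (- A) = - transpose (A :: real ^ 'n ^ 'm)"
  by (simp add: vec_eq_iff transpose_def)

text \<open>
  Expand the determinant over permutations of the enlarged index set. A permutation that moves the
  last index meets a zero entry of the block matrix; those fixing it are exactly the extensions of the
  permutations of the original indices, with the same sign.
\<close>

lemma det_emb:
  fixes k :: "real ^ 'n ^ 'n"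
  shows "det (emb k) = det k * det k"
proof -
  let ?f = "map_permutation UNIV (Some :: 'n \<Rightarrow> 'n option)"
  let ?P = "{p. p permutes (UNIV :: 'n set)}" and ?Q = "{q. q permutes (UNIV :: 'n option set)}"
  let ?t = "\<lambda>q. of_int (sign q) * (\<Prod>i\<in>UNIV. emb k $ i $ q i)"
  have f_Some: "?f p (Some i) = Some (p i)" for p i
    by (rule map_permutation_apply) auto
  have f_perm: "?f p permutes range Some" if "p permutes UNIV" for p
    using that by (intro map_permutation_permutes) (auto simp: bij_betw_def)
  have f_None: "?f p None = None" if "p permutes UNIV" for p
    using permutes_not_in[OF f_perm[OF that]] by blast
  have inj: "inj_on ?f ?P"
    by (rule inj_onI, rule ext) (metis f_Some option.inject)
  have sub: "?f ` ?P \<subseteq> ?Q"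
    using permutes_subset[OF f_perm] by auto
  have zero: "?t q = 0" if q: "q \<in> ?Q - ?f ` ?P" for q
  proof (cases "q None = None")
    case True
    then have "q permutes range Some"
      using q by (auto intro!: permutes_superset[of q UNIV] simp: image_iff)
    then have "map_permutation (range Some) the q permutes UNIV"
      by (intro map_permutation_permutes) (auto simp: bij_betw_def inj_on_def image_iff)
    moreover have "?f (map_permutation (range Some) the q) = q"
      using \<open>q permutes range Some\<close>
      by (intro map_permutation_compose_inv) (auto simp: bij_betw_def inj_on_def image_iff)
    ultimately show ?thesis using q by (metis (mono_tags, lifting) DiffD2 imageI mem_Collect_eq)
  next
    case False
    then have "emb k $ None $ q None = 0" by (auto simp: emb_def split: option.splits)
    then show ?thesis by (auto intro!: prod_zero)
  qed
  have "(\<Prod>i\<in>UNIV. emb k $ i $ ?f p i) = det k * (\<Prod>i\<in>UNIV. k $ i $ p i)" if "p permutes UNIV" for p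
    using f_None[OF that]
    by (simp add: UNIV_option_conv prod.reindex f_Some o_def) (simp add: emb_def)
  then have "?t (?f p) = det k * (of_int (sign p) * (\<Prod>i\<in>UNIV. k $ i $ p i))" if "p \<in> ?P" for p
    using that by (simp add: sign_map_permutation)
  then have "sum ?t (?f ` ?P) = det k * det k"
    unfolding det_def[of k] sum_distrib_left
    by (subst sum.reindex[OF inj]) (auto intro!: sum.cong simp: det_def[of k] sum_distrib_left)
  moreover have "det (emb k) = sum ?t (?f ` ?P)"
    unfolding det_def[of "emb k"] using sub zero by (intro sum.mono_neutral_right) auto
  ultimately show ?thesis by simp
qed

lemma emb_mult: "emb (A ** B) = emb A ** emb (B :: real ^ 'n ^ 'n)"
proof -
  have nth: "(X ** Y) $ i $ j = (\<Sum>l\<in>UNIV. X $ i $ l * Y $ l $ j)"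
    for X Y :: "real ^ 'a ^ 'a" and i j
    by (simp add: matrix_matrix_mult_def)
  have "emb (A ** B) $ i $ j = (emb A ** emb B) $ i $ j" for i j
    by (cases i; cases j)
      (simp_all add: nth emb_def det_mul UNIV_option_conv sum.reindex)
  then show ?thesis by (simp add: vec_eq_iff)
qed

lemma transpose_emb: "transpose (emb k) = emb (transpose k)"
  by (auto simp: vec_eq_iff emb_def transpose_def det_transpose[unfolded transpose_def] split: option.splits)

lemma emb_one: "emb (mat 1) = mat 1"
  by (auto simp: vec_eq_iff emb_def mat_def det_I[unfolded mat_def] split: option.splits)

lemma emb_uminus: "odd CARD('n) \<Longrightarrow> emb (- k) = - emb (k :: real ^ 'n ^ 'n)"
  by (auto simp: vec_eq_iff emb_def det_uminus split: option.splits)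

lemma O_group_iff: "k \<in> O_group \<longleftrightarrow> transpose k ** k = mat 1"
  by (simp add: O_group_def orthogonal_matrix)

lemma SO_group_iff: "k \<in> SO_group \<longleftrightarrow> k \<in> O_group \<and> det k = 1"
  by (simp add: O_group_def SO_group_def)

lemma emb_in_SO_group: "k \<in> O_group \<Longrightarrow> emb k \<in> SO_group"
  using det_orthogonal_matrix[of k]
  by (auto simp: SO_group_iff det_emb transpose_emb O_group_iff emb_one orthogonal_matrix simp flip: emb_mult)

lemma matrix_inv_O_group: "k \<in> O_group \<Longrightarrow> matrix_inv k = transpose (k :: real ^ 'n ^ 'n)"
proof -
  assume "k \<in> O_group"
  then have k: "transpose k ** k = mat 1" "k ** transpose k = mat 1"
    by (simp_all add: O_group_def orthogonal_matrix_def)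
  then have "k ** matrix_inv k = mat 1"
    unfolding matrix_inv_def by (rule_tac someI2[of _ "transpose k"]) auto
  then show ?thesis
    using k by (metis matrix_mul_assoc matrix_mul_lid matrix_mul_rid)
qed

lemma O_group_mult: "h \<in> O_group \<Longrightarrow> k \<in> O_group \<Longrightarrow> h ** k \<in> O_group"
  by (simp add: O_group_def orthogonal_matrix_mul)

lemma O_group_transpose: "k \<in> O_group \<Longrightarrow> transpose k \<in> O_group"
  by (simp add: O_group_def)

lemma SO_group_mult: "h \<in> SO_group \<Longrightarrow> k \<in> SO_group \<Longrightarrow> h ** k \<in> SO_group"
  by (simp add: SO_group_iff O_group_mult det_mul)

lemma SO_group_transpose: "k \<in> SO_group \<Longrightarrow> transpose k \<in> SO_group"
  by (simp add: SO_group_iff O_group_transpose)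

lemma O_group_uminus: "- k \<in> O_group \<longleftrightarrow> k \<in> O_group"
  by (simp add: O_group_iff matrix_mul_uminus_left matrix_mul_uminus_right transpose_uminus)

lemma uminus_one_in_SO_group: "even CARD('n) \<Longrightarrow> - mat 1 \<in> (SO_group :: (real ^ 'n ^ 'n) set)"
  by (simp add: SO_group_iff det_uminus O_group_uminus)
    (simp add: O_group_def orthogonal_matrix_id)

lemma uminus_in_SO_group_iff:
  fixes h :: "real ^ 'n ^ 'n"
  assumes odd: "odd CARD('n)" and h: "h \<in> O_group"
  shows "- h \<in> SO_group \<longleftrightarrow> h \<notin> SO_group"
proof -
  have "det h = 1 \<or> det h = - 1" using h det_orthogonal_matrix by (auto simp: O_group_def)
  then show ?thesis using odd h by (auto simp: SO_group_iff O_group_uminus det_uminus)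
qed

lemma continuous_on_matrix_mult [continuous_intros]:
  fixes f :: "'a::topological_space \<Rightarrow> real ^ 'n ^ 'm" and g :: "'a \<Rightarrow> real ^ 'k ^ 'n"
  assumes "continuous_on S f" "continuous_on S g"
  shows "continuous_on S (\<lambda>x. f x ** g x)"
  unfolding matrix_matrix_mult_def by (intro continuous_intros assms)

lemma continuous_on_det [continuous_intros]:
  fixes f :: "'a::topological_space \<Rightarrow> real ^ 'n ^ 'n"
  assumes "continuous_on S f" shows "continuous_on S (\<lambda>x. det (f x))"
  unfolding det_def by (intro continuous_intros assms)

lemma continuous_on_transpose [continuous_intros]:
  fixes f :: "'a::topological_space \<Rightarrow> real ^ 'n ^ 'm"
  assumes "continuous_on S f" shows "continuous_on S (\<lambda>x. transpose (f x))"
  unfolding transpose_def by (intro continuous_intros assms)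

lemma continuous_on_emb: "continuous_on S (emb :: real ^ 'n ^ 'n \<Rightarrow> _)"
proof -
  have "continuous_on S (\<lambda>k :: real ^ 'n ^ 'n. case (i, j) of
       (Some i', Some j') \<Rightarrow> k $ i' $ j' | (None, None) \<Rightarrow> det k | _ \<Rightarrow> 0)" for i j
    by (cases i; cases j) (auto intro!: continuous_intros)
  then show ?thesis unfolding emb_def[abs_def] by (intro continuous_on_vec_lambda)
qed

lemma compact_O_group: "compact (O_group :: (real ^ 'n ^ 'n) set)"
proof -
  have "closed (O_group :: (real ^ 'n ^ 'n) set)"
    unfolding O_group_def orthogonal_matrix by (intro closed_Collect_eq continuous_intros)
  moreover have "bounded (O_group :: (real ^ 'n ^ 'n) set)"
  proof (rule boundedI)
    fix k :: "real ^ 'n ^ 'n" assume "k \<in> O_group"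
    then have "norm (k $ i) = 1" for i
      by (auto simp: O_group_def orthogonal_matrix_orthonormal_rows row_def)
    then show "norm k \<le> sqrt CARD('n)" by (simp add: norm_vec_def L2_set_def)
  qed
  ultimately show ?thesis using compact_eq_bounded_closed by blast
qed

lemma compact_SO_group: "compact (SO_group :: (real ^ 'n ^ 'n) set)"
proof -
  have "closed {k :: real ^ 'n ^ 'n. det k = 1}"
    by (intro closed_Collect_eq continuous_intros)
  moreover have "SO_group = O_group \<inter> {k :: real ^ 'n ^ 'n. det k = 1}"
    by (auto simp: SO_group_iff)
  ultimately show ?thesis using compact_O_group by (metis compact_Int_closed)
qed

section \<open>Uniqueness of Haar measure and integration over the two cosets of \<open>SO(n)\<close>\<close>

lemma haar_prob: "normalized_haar K \<mu> \<Longrightarrow> prob_space \<mu>"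
  and haar_sets: "normalized_haar K \<mu> \<Longrightarrow> sets \<mu> = sets (restrict_space borel K)"
  and haar_left: "normalized_haar K \<mu> \<Longrightarrow> k \<in> K \<Longrightarrow> distr \<mu> \<mu> (\<lambda>x. k ** x) = \<mu>"
  by (simp_all add: normalized_haar_def)

lemma haar_space: "normalized_haar K \<mu> \<Longrightarrow> space \<mu> = K"
  using sets_eq_imp_space_eq[OF haar_sets] by (fastforce simp: space_restrict_space)

lemma integrable_haar:
  fixes f :: "real ^ 'n ^ 'n \<Rightarrow> 'b :: {banach, second_countable_topology}"
  assumes "compact K" "normalized_haar K \<mu>" "continuous_on K f"
  shows "integrable \<mu> f"
proof -
  interpret prob_space \<mu> using assms(2) by (rule haar_prob)
  have "f \<in> borel_measurable \<mu>"
    using borel_measurable_continuous_on_restrict[OF assms(3)] measurable_cong_sets[OF haar_sets[OF assms(2)] refl]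
    by blast
  moreover obtain C where "\<And>k. k \<in> K \<Longrightarrow> norm (f k) \<le> C"
    using compact_imp_bounded[OF compact_continuous_image[OF assms(3,1)]]
    by (auto simp: bounded_iff)
  ultimately show ?thesis
    using haar_space[OF assms(2)] by (intro integrable_const_bound[where B = C]) auto
qed

text \<open>
  For orthogonal matrices transposition is inversion, so a nonempty set of this kind is a
  subgroup of \<open>O(n)\<close>. Inversion thereby becomes a linear, hence visibly measurable, map.
\<close>

definition closed_under_mult_inv :: "(real ^ 'n ^ 'n) set \<Rightarrow> bool" where
  "closed_under_mult_inv K \<longleftrightarrow>
     K \<subseteq> O_group \<and> (\<forall>g\<in>K. \<forall>h\<in>K. g ** h \<in> K) \<and> (\<forall>g\<in>K. transpose g \<in> K)"

lemma haar_left_nn_integral: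
  assumes "normalized_haar K \<mu>" "k \<in> K" "\<And>h. h \<in> K \<Longrightarrow> k ** h \<in> K" "f \<in> borel_measurable \<mu>"
  shows "(\<integral>\<^sup>+ x. f (k ** x) \<partial>\<mu>) = (\<integral>\<^sup>+ x. f x \<partial>\<mu>)"
proof -
  have "continuous_on UNIV (\<lambda>x. k ** x)" by (intro continuous_intros)
  then have "(\<lambda>x. k ** x) \<in> measurable (restrict_space borel K) (restrict_space borel K)"
    using assms(3) by (intro measurable_restrict_space3 borel_measurable_continuous_onI) auto
  then have "(\<lambda>x. k ** x) \<in> measurable \<mu> \<mu>"
    using measurable_cong_sets[OF haar_sets[OF assms(1)] haar_sets[OF assms(1)]] by blast
  then have "(\<integral>\<^sup>+ x. f x \<partial>distr \<mu> \<mu> (\<lambda>x. k ** x)) = (\<integral>\<^sup>+ x. f (k ** x) \<partial>\<mu>)"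
    using assms(4) by (intro nn_integral_distr) simp_all
  then show ?thesis using haar_left[OF assms(1,2)] by simp
qed

text \<open>
  Integrate the indicator of \<open>E\<close> at \<open>y\<^sup>-\<^sup>1 x\<close> against both measures. Integrating over \<open>x\<close> first, left
  invariance of \<open>\<mu>\<close> gives \<open>\<mu> E\<close>; integrating over \<open>y\<close> first, \<open>y\<^sup>-\<^sup>1 x\<close> is the inverse of
  \<open>x\<^sup>-\<^sup>1 y\<close>, and left invariance of \<open>\<mu>'\<close> gives the mass of \<open>E\<close> under the inverted measure \<open>\<mu>'\<close>.
\<close>

lemma haar_eq_distr_transpose:
  fixes \<mu> \<mu>' :: "(real ^ 'n ^ 'n) measure"
  assumes K: "closed_under_mult_inv K" and \<mu>: "normalized_haar K \<mu>" and \<mu>': "normalized_haar K \<mu>'"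
  shows "\<mu> = distr \<mu>' \<mu> transpose"
proof (rule measure_eqI)
  interpret M: prob_space \<mu> using \<mu> by (rule haar_prob)
  interpret M': prob_space \<mu>' using \<mu>' by (rule haar_prob)
  interpret P: pair_sigma_finite \<mu> \<mu>' ..
  note sets_cong = measurable_cong_sets[OF haar_sets[OF \<mu>'] haar_sets[OF \<mu>]]
  have transp: "transpose \<in> measurable \<mu>' \<mu>"
    unfolding sets_cong using K
    by (intro measurable_restrict_space3 borel_measurable_continuous_onI continuous_intros)
      (auto simp: closed_under_mult_inv_def)
  have id: "(\<lambda>x. x) \<in> measurable \<mu> borel" "(\<lambda>x. x) \<in> measurable \<mu>' borel"
    using measurable_restrict_space1[of "\<lambda>x. x" borel borel K]
    by (simp_all add: measurable_cong_sets[OF haar_sets[OF \<mu>] refl] measurable_cong_sets[OF haar_sets[OF \<mu>'] refl])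
  have "continuous_on UNIV (\<lambda>(x, y). transpose y ** (x :: real ^ 'n ^ 'n))"
    unfolding split_beta by (intro continuous_intros)
  then have "(\<lambda>(x, y). transpose y ** (x :: real ^ 'n ^ 'n)) \<in> borel_measurable (borel \<Otimes>\<^sub>M borel)"
    unfolding borel_prod by (rule borel_measurable_continuous_onI)
  then have "(\<lambda>p. (\<lambda>(x, y). transpose y ** x) ((\<lambda>p. (fst p, snd p)) p)) \<in> borel_measurable (\<mu> \<Otimes>\<^sub>M \<mu>')"
    by (rule measurable_compose[rotated])
      (intro measurable_Pair measurable_compose[OF measurable_fst id(1)] measurable_compose[OF measurable_snd id(2)])
  then have mult: "(\<lambda>(x, y). transpose y ** x) \<in> measurable (\<mu> \<Otimes>\<^sub>M \<mu>') \<mu>"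
    using K haar_space[OF \<mu>] haar_space[OF \<mu>']
    unfolding measurable_cong_sets[OF refl haar_sets[OF \<mu>]]
    by (intro measurable_restrict_space2) (auto simp: space_pair_measure closed_under_mult_inv_def split_beta)
  fix E assume E: "E \<in> sets \<mu>"
  have ind: "(\<lambda>x. indicator E x :: ennreal) \<in> borel_measurable \<mu>" using E by simp
  have indT: "(\<lambda>x. indicator E (transpose x) :: ennreal) \<in> borel_measurable \<mu>'"
    using measurable_compose[OF transp ind] .
  have "emeasure \<mu> E = (\<integral>\<^sup>+ y. (\<integral>\<^sup>+ x. indicator E x \<partial>\<mu>) \<partial>\<mu>')"
    using E by (simp add: M'.emeasure_space_1)
  also have "\<dots> = (\<integral>\<^sup>+ y. (\<integral>\<^sup>+ x. indicator E (transpose y ** x) \<partial>\<mu>) \<partial>\<mu>')"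
    using K haar_space[OF \<mu>']
    by (intro nn_integral_cong haar_left_nn_integral[symmetric, OF \<mu> _ _ ind])
      (auto simp: closed_under_mult_inv_def)
  also have "\<dots> = (\<integral>\<^sup>+ x. (\<integral>\<^sup>+ y. indicator E (transpose y ** x) \<partial>\<mu>') \<partial>\<mu>)"
    using measurable_compose[OF mult ind] by (intro P.Fubini') (simp add: split_beta)
  also have "\<dots> = (\<integral>\<^sup>+ x. (\<integral>\<^sup>+ y. indicator E (transpose (transpose x ** y)) \<partial>\<mu>') \<partial>\<mu>)"
    by (simp add: matrix_transpose_mul)
  also have "\<dots> = (\<integral>\<^sup>+ x. (\<integral>\<^sup>+ y. indicator E (transpose y) \<partial>\<mu>') \<partial>\<mu>)"
    using K haar_space[OF \<mu>]
    by (intro nn_integral_cong haar_left_nn_integral[OF \<mu>' _ _ indT])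
      (auto simp: closed_under_mult_inv_def)
  also have "\<dots> = (\<integral>\<^sup>+ y. indicator E (transpose y) \<partial>\<mu>')"
    by (simp add: M.emeasure_space_1)
  also have "\<dots> = emeasure (distr \<mu>' \<mu> transpose) E"
    using E nn_integral_distr[OF transp, of "indicator E"] ind by simp
  finally show "emeasure \<mu> E = emeasure (distr \<mu>' \<mu> transpose) E" .
qed simp

text \<open>
  Both measures are the image under inversion of one and the same Haar measure.
\<close>

lemma haar_unique:
  assumes K: "closed_under_mult_inv K" and \<mu>: "normalized_haar K \<mu>" and \<mu>': "normalized_haar K \<mu>'"
  shows "\<mu> = \<mu>'"
proof -
  have "distr \<mu> \<mu> transpose = distr \<mu> \<mu>' transpose"
    using haar_sets[OF \<mu>] haar_sets[OF \<mu>'] by (intro distr_cong) auto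
  then show ?thesis
    using haar_eq_distr_transpose[OF K \<mu> \<mu>] haar_eq_distr_transpose[OF K \<mu>' \<mu>] by simp
qed

lemma closed_under_mult_inv_SO_group: "closed_under_mult_inv SO_group"
  using SO_group_mult SO_group_transpose SO_group_iff unfolding closed_under_mult_inv_def by blast

text \<open>
  For odd \<open>n\<close> the group \<open>O(n)\<close> is the disjoint union of \<open>SO(n)\<close> and its translate by \<open>- 1\<close>. Invariance
  gives both cosets mass one half, and twice the restriction of \<open>\<nu>\<close> to \<open>SO(n)\<close> is a normalized Haar
  measure there, hence equals \<open>\<mu>\<close>.
\<close>

lemma integral_haar_O_group:
  fixes f :: "real ^ 'n ^ 'n \<Rightarrow> 'b :: {banach, second_countable_topology}"
  assumes odd: "odd CARD('n)" and \<mu>: "normalized_haar SO_group \<mu>" and \<nu>: "normalized_haar O_group \<nu>"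
    and f: "continuous_on O_group f"
  shows "(LINT h|\<nu>. f h) = (1/2) *\<^sub>R ((LINT k|\<mu>. f k) + (LINT k|\<mu>. f (- k)))"
proof -
  let ?S = "SO_group :: (real ^ 'n ^ 'n) set" and ?O = "O_group :: (real ^ 'n ^ 'n) set"
  interpret N: prob_space \<nu> using \<nu> by (rule haar_prob)
  have space: "space \<nu> = ?O" using \<nu> by (rule haar_space)
  have sub: "?S \<subseteq> ?O" by (auto simp: SO_group_iff)
  have S: "?S \<in> sets \<nu>"
    unfolding haar_sets[OF \<nu>] using sub compact_imp_closed[OF compact_SO_group]
    by (subst sets_restrict_space) (auto simp: image_iff intro!: bexI[of _ ?S] borel_closed)
  have left: "(\<lambda>x. k ** x) \<in> measurable \<nu> \<nu>" if "k \<in> ?O" for k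
    unfolding measurable_cong_sets[OF haar_sets[OF \<nu>] haar_sets[OF \<nu>]]
    using that O_group_mult
    by (intro measurable_restrict_space3 borel_measurable_continuous_onI continuous_intros) auto
  have inv: "emeasure \<nu> ((\<lambda>x. k ** x) -` E \<inter> ?O) = emeasure \<nu> E" if "k \<in> ?O" "E \<in> sets \<nu>" for k E
    using emeasure_distr[OF left[OF that(1)] that(2)] haar_left[OF \<nu> that(1)] space by simp
  have a: "- mat 1 \<in> ?O" unfolding O_group_uminus by (simp add: O_group_def orthogonal_matrix_id)
  have a_mult: "(- mat 1) ** h = - h" for h :: "real ^ 'n ^ 'n"
    by (simp add: matrix_mul_uminus_left)
  have neg: "- h \<in> ?S \<longleftrightarrow> h \<notin> ?S" if "h \<in> ?O" for h
    using odd that by (rule uminus_in_SO_group_iff)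
  have "(\<lambda>h. - mat 1 ** h) -` ?S \<inter> ?O = space \<nu> - ?S"
    using neg by (auto simp: a_mult space)
  then have "emeasure \<nu> (space \<nu> - ?S) = emeasure \<nu> ?S"
    using inv[OF a S] by simp
  then have "N.prob (space \<nu> - ?S) = N.prob ?S" by (simp add: measure_def)
  then have "N.prob ?S = 1/2" using N.prob_compl[OF S] by linarith
  then have half: "emeasure \<nu> ?S = ennreal (1/2)"
    by (simp only: N.emeasure_eq_measure)
  define \<mu>' where "\<mu>' = density (restrict_space \<nu> ?S) (\<lambda>_. ennreal 2)"
  have sets_\<mu>': "sets \<mu>' = sets (restrict_space borel ?S)"
    using sub by (simp add: \<mu>'_def sets_restrict_space_cong[OF haar_sets[OF \<nu>]] restrict_restrict_space
      sets_restrict_restrict_space Int_absorb1)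
  have em: "emeasure \<mu>' E = 2 * emeasure \<nu> E" if "E \<in> sets \<mu>'" for E
    using that S space sub unfolding \<mu>'_def
    by (subst emeasure_density_const) (auto simp: emeasure_restrict_space sets_restrict_space)
  have space_\<mu>': "space \<mu>' = ?S" using space sub by (auto simp: \<mu>'_def space_restrict_space)
  have "normalized_haar ?S \<mu>'"
    unfolding normalized_haar_def
  proof (intro conjI ballI)
    have "2 * ennreal (1/2) = ennreal 2 * ennreal (1/2)" by simp
    also have "\<dots> = 1" by (subst ennreal_mult[symmetric]) auto
    finally have "2 * ennreal (1/2) = 1" .
    then show "prob_space \<mu>'"
      using em[OF sets.top] unfolding space_\<mu>' half by (intro prob_spaceI) (simp only: space_\<mu>')
  next
    show "sets \<mu>' = sets (restrict_space borel ?S)" by (rule sets_\<mu>')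
  next
    fix k assume k: "k \<in> ?S"
    have meas: "(\<lambda>x. k ** x) \<in> measurable \<mu>' \<mu>'"
      unfolding measurable_cong_sets[OF sets_\<mu>' sets_\<mu>'] using k SO_group_mult
      by (intro measurable_restrict_space3 borel_measurable_continuous_onI continuous_intros) auto
    show "distr \<mu>' \<mu>' (\<lambda>x. k ** x) = \<mu>'"
    proof (rule measure_eqI)
      fix E assume "E \<in> sets (distr \<mu>' \<mu>' (\<lambda>x. k ** x))"
      then have E: "E \<in> sets \<mu>'" by simp
      then have E': "E \<in> sets \<nu>" "E \<subseteq> ?S"
        using S sets.sets_into_space[OF E] unfolding space_\<mu>'
        by (auto simp: \<mu>'_def sets_restrict_space)
      have "h \<in> ?S" if "k ** h \<in> E" "h \<in> ?O" for h
        using that E'(2) k by (auto simp: SO_group_iff det_mul)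
      then have "(\<lambda>x. k ** x) -` E \<inter> ?S = (\<lambda>x. k ** x) -` E \<inter> ?O" using sub by auto
      then show "emeasure (distr \<mu>' \<mu>' (\<lambda>x. k ** x)) E = emeasure \<mu>' E"
        using E meas k sub measurable_sets[OF meas E]
        by (auto simp: emeasure_distr em space_\<mu>' inv E'(1))
    qed simp
  qed
  then have \<mu>_eq: "\<mu> = \<mu>'" by (rule haar_unique[OF closed_under_mult_inv_SO_group \<mu>])
  \<comment> \<open>the contribution of one coset; the other one is moved to it by the substitution \<open>h \<mapsto> - h\<close>\<close>
  have half_int: "(LINT h|\<nu>. indicator ?S h *\<^sub>R g h) = (1/2) *\<^sub>R (LINT k|\<mu>. g k)"
    if g: "continuous_on ?O g" for g :: "_ \<Rightarrow> 'b"
  proof -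
    have "g \<in> borel_measurable (restrict_space \<nu> ?S)"
      using integrable_haar[OF compact_O_group \<nu> g] by (intro measurable_restrict_space1) simp
    then have "(LINT k|\<mu>. g k) = (LINT k|restrict_space \<nu> ?S. 2 *\<^sub>R g k)"
      unfolding \<mu>_eq \<mu>'_def by (intro integral_density) auto
    also have "\<dots> = 2 *\<^sub>R (LINT h|\<nu>. indicator ?S h *\<^sub>R g h)"
      using S by (simp add: integral_restrict_space scaleR_left_commute[of _ 2] del: scaleR_scaleR)
    finally show ?thesis by simp
  qed
  have f': "continuous_on ?O (\<lambda>h. f (- h))"
    using O_group_uminus by (intro continuous_on_compose2[OF f] continuous_intros) auto
  have int: "integrable \<nu> f" "integrable \<nu> (\<lambda>h. f (- h))"
    using integrable_haar[OF compact_O_group \<nu>] f f' by auto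
  have "(LINT h|\<nu>. f h) = (LINT h|\<nu>. indicator ?S h *\<^sub>R f h + indicator (- ?S) h *\<^sub>R f h)"
    by (intro Bochner_Integration.integral_cong) (auto simp: indicator_def)
  also have "\<dots> = (LINT h|\<nu>. indicator ?S h *\<^sub>R f h) + (LINT h|\<nu>. indicator (space \<nu> - ?S) h *\<^sub>R f h)"
    using Bochner_Integration.integral_add[OF integrable_mult_indicator[OF S int(1)]
        integrable_mult_indicator[OF sets.compl_sets[OF S] int(1)]]
    by (simp add: indicator_def cong: Bochner_Integration.integral_cong)
  also have "(LINT h|\<nu>. indicator (space \<nu> - ?S) h *\<^sub>R f h)
      = (LINT h|distr \<nu> \<nu> (\<lambda>h. (- mat 1) ** h). indicator (space \<nu> - ?S) h *\<^sub>R f h)"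
    using haar_left[OF \<nu> a] by simp
  also have "\<dots> = (LINT h|\<nu>. indicator (space \<nu> - ?S) ((- mat 1) ** h) *\<^sub>R f ((- mat 1) ** h))"
    using S int(1) by (intro integral_distr left a) auto
  also have "\<dots> = (LINT h|\<nu>. indicator ?S h *\<^sub>R f (- h))"
    using neg O_group_uminus space by (intro Bochner_Integration.integral_cong) (auto simp: indicator_def a_mult)
  finally show ?thesis
    by (simp add: half_int[OF f] half_int[OF f'] scaleR_add_right)
qed

section \<open>Traces and characters of unitary representations\<close>

lemma unitary_repD:
  assumes "unitary_rep K \<tau>"
  shows "g \<in> K \<Longrightarrow> clinear (\<tau> g)" "g \<in> K \<Longrightarrow> cinner (\<tau> g v) (\<tau> g w) = cinner v w"
    "\<tau> (mat 1) = id" "g \<in> K \<Longrightarrow> h \<in> K \<Longrightarrow> \<tau> (g ** h) v = \<tau> g (\<tau> h v)"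
    "continuous_on K (\<lambda>g. \<tau> g v)"
  using assms by (auto simp: unitary_rep_def)

lemma ctrace_scaleC: "clinear f \<Longrightarrow> ctrace (\<lambda>v. c *\<^sub>C f v) = c * ctrace f"
  by (subst (1 2) ctrace_eq_sum_cinner_Basis)
    (auto intro: clinearI simp: clinear_add clinear_scaleC scaleC_add_right scaleC_scaleC mult.commute
      cinner_scaleC_left sum_distrib_left)

lemma ctrace_unitary_inverse:
  assumes \<tau>: "unitary_rep K \<tau>" and K: "g \<in> K" "h \<in> K" "g ** h = mat 1"
  shows "ctrace (\<tau> h) = cnj (ctrace (\<tau> g))"
proof -
  have "cinner (\<tau> h b) b = cnj (cinner (\<tau> g b) b)" for b
  proof -
    have "cinner (\<tau> h b) b = cinner (\<tau> g (\<tau> h b)) (\<tau> g b)"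
      using unitary_repD(2)[OF \<tau> K(1)] by simp
    also have "\<tau> g (\<tau> h b) = b"
      using unitary_repD(3,4)[OF \<tau>] K by (metis id_apply)
    finally show ?thesis by (subst cinner_commute) simp
  qed
  then show ?thesis
    using unitary_repD(1)[OF \<tau>] K by (simp add: ctrace_eq_sum_cinner_Basis)
qed

lemma continuous_on_ctrace:
  assumes \<tau>: "unitary_rep K \<tau>"
  shows "continuous_on K (\<lambda>g. ctrace (\<tau> g))"
proof -
  have "continuous_on K (\<lambda>g. (\<Sum>b\<in>Basis. cinner (\<tau> g b) b) / 2)"
    using unitary_repD(5)[OF \<tau>]
    by (intro continuous_intros bounded_linear.continuous_on[OF bounded_linear_cinner_left]) auto
  then show ?thesis
    by (rule continuous_on_eq) (simp add: ctrace_eq_sum_cinner_Basis unitary_repD(1)[OF \<tau>])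
qed

lemma chi_inverse:
  assumes \<pi>: "unitary_rep SO_group \<pi>" and k: "k \<in> SO_group"
  shows "chi \<pi> (matrix_inv k) = cnj (chi \<pi> k)"
proof -
  have "k ** transpose k = mat 1" "matrix_inv k = transpose k"
    using k matrix_inv_O_group by (auto simp: SO_group_iff O_group_def orthogonal_matrix_def)
  then show ?thesis
    using ctrace_unitary_inverse[OF \<pi> k SO_group_transpose[OF k]] by (simp add: chi_def)
qed

lemma continuous_on_chi_scaleC:
  assumes \<pi>: "unitary_rep SO_group \<pi>" and \<phi>: "continuous_on SO_group \<phi>"
  shows "continuous_on SO_group (\<lambda>k. chi \<pi> (matrix_inv k) *\<^sub>C \<phi> k)"
proof -
  have "continuous_on SO_group (\<lambda>k. cnj (chi \<pi> k) *\<^sub>C \<phi> k)"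
    unfolding chi_def
    by (intro bounded_bilinear.continuous_on[OF bounded_bilinear_scaleC] continuous_intros
        continuous_on_ctrace \<pi> \<phi>)
  then show ?thesis
    using chi_inverse[OF \<pi>] by (simp cong: continuous_on_cong)
qed

lemma continuous_on_rep_emb:
  assumes "unitary_rep SO_group \<tau>"
  shows "continuous_on SO_group (\<lambda>k. \<tau> (emb k) v)"
  using emb_in_SO_group
  by (intro continuous_on_compose2[OF unitary_repD(5)[OF assms] continuous_on_emb])
    (auto simp: SO_group_iff[of "_ :: real^'a^'a"])

section \<open>The isotypic projections for \<open>\<pi>\<close> and for \<open>\<pi> \<otimes> \<psi>\<close>\<close>

text \<open>
  The two cosets are disjoint closed sets, so continuity can be tested on each of them.
\<close>

lemma continuous_on_SO_cosets:
  fixes f :: "real ^ 'n ^ 'n \<Rightarrow> 'b :: topological_space"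
  assumes odd: "odd CARD('n)"
    and f: "continuous_on SO_group f" "continuous_on SO_group (\<lambda>k. f (- k))"
  shows "continuous_on O_group f"
proof -
  let ?S = "SO_group :: (real ^ 'n ^ 'n) set"
  have "continuous_on (uminus ` ?S) (\<lambda>h. f (- (- h)))"
    by (intro continuous_on_compose2[OF f(2)] continuous_intros) auto
  then have "continuous_on (uminus ` ?S) f" by simp
  moreover have "compact (uminus ` ?S)"
    by (intro compact_continuous_image compact_SO_group continuous_intros)
  ultimately have "continuous_on (?S \<union> uminus ` ?S) f"
    using f(1) compact_SO_group by (intro continuous_on_closed_Un compact_imp_closed)
  moreover have "h \<in> ?S \<or> - h \<in> ?S" if "h \<in> O_group" for h
    using uminus_in_SO_group_iff[OF odd that] by blast
  then have "O_group \<subseteq> ?S \<union> uminus ` ?S" by (metis UnI1 UnI2 imageI minus_minus subsetI)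
  ultimately show ?thesis by (rule continuous_on_subset)
qed

text \<open>
  The determinant of \<open>k ** x\<close> recovers \<open>x\<close>, because \<open>det (- 1) = - 1\<close> for odd \<open>n\<close>.
\<close>

lemma tensor_char_mult:
  fixes k :: "real ^ 'n ^ 'n"
  assumes odd: "odd CARD('n)" and k: "k \<in> SO_group" and x: "x \<in> F_group"
  shows "tensor_char \<pi> \<psi> (k ** x) = (\<lambda>v. \<psi> x *\<^sub>C \<pi> k v)"
proof -
  have "(THE (k', x'). k' \<in> SO_group \<and> x' \<in> F_group \<and> k ** x = k' ** x') = (k, x)"
  proof (rule the_equality)
    fix p :: "(real ^ 'n ^ 'n) \<times> (real ^ 'n ^ 'n)"
    obtain k' x' where p: "p = (k', x')" by (cases p)
    assume "case p of (k', x') \<Rightarrow> k' \<in> SO_group \<and> x' \<in> F_group \<and> k ** x = k' ** x'"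
    then have *: "k' \<in> SO_group" "x' \<in> F_group" "k ** x = k' ** x'" by (auto simp: p)
    have "det k' = 1" "det k = 1" using *(1) k by (auto simp: SO_group_iff)
    then have "det x = det x'" using arg_cong[OF *(3), of det] by (simp add: det_mul)
    then have "x = x'" using x *(2) odd by (auto simp: F_group_def det_uminus)
    then show "p = (k, x)"
      using *(3) x by (auto simp: p F_group_def matrix_mul_uminus_right)
  qed (use k x in auto)
  then show ?thesis by (simp add: tensor_char_def)
qed

text \<open>
  On the coset of \<open>- 1\<close> the character of \<open>\<pi> \<otimes> \<psi>\<close> is \<open>\<psi>(- 1)\<close> times that of \<open>\<pi>\<close>, and the factor \<open>emb (- 1)\<close>,
  which is again minus the identity, can be absorbed into the argument of \<open>\<tau>\<close>. The two cosets then give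
  the two terms.
\<close>

lemma isotypic_proj_tensor_char:
  fixes \<tau> :: "real ^ ('n::finite option) ^ ('n option) \<Rightarrow> 'v::hermitian_space \<Rightarrow> 'v"
    and \<pi> :: "real ^ 'n ^ 'n \<Rightarrow> 'w::hermitian_space \<Rightarrow> 'w"
  assumes odd: "odd CARD('n)"
    and \<tau>: "unitary_rep SO_group \<tau>" and \<pi>: "unitary_rep SO_group \<pi>"
    and \<mu>: "normalized_haar SO_group \<mu>" and \<nu>: "normalized_haar O_group \<nu>"
    and \<psi>: "\<psi> (mat 1) = 1"
  shows "isotypic_proj \<nu> \<tau> (tensor_char \<pi> \<psi>) v =
    (1/2) *\<^sub>R (isotypic_proj \<mu> \<tau> \<pi> v + \<psi> (- mat 1) *\<^sub>C isotypic_proj \<mu> \<tau> \<pi> (\<tau> (- mat 1) v))"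
proof -
  let ?\<gamma> = "tensor_char \<pi> \<psi>" and ?a = "- mat 1 :: real ^ 'n option ^ 'n option"
  let ?F = "\<lambda>h. chi ?\<gamma> (matrix_inv h) *\<^sub>C \<tau> (emb h) v"
  have F: "?F k = chi \<pi> (matrix_inv k) *\<^sub>C \<tau> (emb k) v"
    "?F (- k) = \<psi> (- mat 1) *\<^sub>C chi \<pi> (matrix_inv k) *\<^sub>C \<tau> (emb k) (\<tau> ?a v)"
    if k: "k \<in> SO_group" for k :: "real ^ 'n ^ 'n"
  proof -
    have O: "k \<in> O_group" "- k \<in> O_group" using k by (auto simp: SO_group_iff O_group_uminus)
    have inv: "matrix_inv k = transpose k" "matrix_inv (- k) = transpose k ** (- mat 1)"
      using O by (auto simp: matrix_inv_O_group transpose_uminus matrix_mul_uminus_right)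
    have kT: "transpose k \<in> SO_group" using k by (rule SO_group_transpose)
    have "?\<gamma> (transpose k) = (\<lambda>v. \<psi> (mat 1) *\<^sub>C \<pi> (transpose k) v)"
      using tensor_char_mult[OF odd kT, of "mat 1"] by (simp add: F_group_def)
    then show "?F k = chi \<pi> (matrix_inv k) *\<^sub>C \<tau> (emb k) v"
      by (simp add: inv chi_def \<psi> scaleC_one)
    have "emb (- k) = emb k ** ?a" by (simp add: emb_uminus odd matrix_mul_uminus_right)
    moreover have "?a \<in> SO_group"
      using odd by (intro uminus_one_in_SO_group) simp
    ultimately have "\<tau> (emb (- k)) v = \<tau> (emb k) (\<tau> ?a v)"
      using unitary_repD(4)[OF \<tau> emb_in_SO_group[OF O(1)]] by simp
    then show "?F (- k) = \<psi> (- mat 1) *\<^sub>C chi \<pi> (matrix_inv k) *\<^sub>C \<tau> (emb k) (\<tau> ?a v)"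
      using tensor_char_mult[OF odd kT, of "- mat 1" \<pi> \<psi>] unitary_repD(1)[OF \<pi> kT]
      by (simp add: inv F_group_def chi_def ctrace_scaleC scaleC_scaleC mult_ac)
  qed
  have cont: "continuous_on SO_group (\<lambda>k. chi \<pi> (matrix_inv k) *\<^sub>C \<tau> (emb k) u)" for u
    by (intro continuous_on_chi_scaleC \<pi> continuous_on_rep_emb \<tau>)
  have bl: "bounded_linear (\<lambda>x :: 'v. c *\<^sub>C x)" for c
    by (rule clinear_bounded_linear[OF clinear_scaleC_right])
  have "continuous_on O_group ?F"
    by (rule continuous_on_SO_cosets[OF odd
          continuous_on_eq[OF cont F(1)[symmetric]]
          continuous_on_eq[OF bounded_linear.continuous_on[OF bl cont] F(2)[symmetric]]])
  then have "isotypic_proj \<nu> \<tau> ?\<gamma> v = (1/2) *\<^sub>R ((LINT k|\<mu>. ?F k) + (LINT k|\<mu>. ?F (- k)))"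
    unfolding isotypic_proj_def by (rule integral_haar_O_group[OF odd \<mu> \<nu>])
  also have "(LINT k|\<mu>. ?F k) = isotypic_proj \<mu> \<tau> \<pi> v"
    unfolding isotypic_proj_def using F(1) haar_space[OF \<mu>]
    by (intro Bochner_Integration.integral_cong) auto
  also have "(LINT k|\<mu>. ?F (- k)) = (LINT k|\<mu>. \<psi> (- mat 1) *\<^sub>C chi \<pi> (matrix_inv k) *\<^sub>C \<tau> (emb k) (\<tau> ?a v))"
    using F(2) haar_space[OF \<mu>] by (intro Bochner_Integration.integral_cong) auto
  also have "\<dots> = \<psi> (- mat 1) *\<^sub>C isotypic_proj \<mu> \<tau> \<pi> (\<tau> ?a v)"
    unfolding isotypic_proj_def
    by (intro integral_bounded_linear bl integrable_haar[OF compact_SO_group \<mu>] cont)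
  finally show ?thesis .
qed

section \<open>The sign of \<open>\<tau>(- I)\<close>\<close>

text \<open>
  An instance of Schur's lemma: the fixed space of \<open>\<tau> z\<close> is an invariant subspace. If it is everything,
  \<open>\<sigma> = 1\<close>; if it is zero, then \<open>v + \<tau> z v\<close>, being fixed, vanishes for every \<open>v\<close>, and \<open>\<sigma> = - 1\<close>.
\<close>

lemma central_involution_scalar:
  assumes \<tau>: "unitary_rep K \<tau>" "irreducible_rep K \<tau>"
    and z: "z \<in> K" "z ** z = mat 1" "\<And>g. g \<in> K \<Longrightarrow> z ** g = g ** z"
  obtains \<sigma> where "\<sigma> = 1 \<or> \<sigma> = - 1" "\<And>v. \<tau> z v = \<sigma> *\<^sub>C v"
proof -
  note lin = unitary_repD(1)[OF \<tau>(1) z(1)]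
  have sq: "\<tau> z (\<tau> z v) = v" for v
    using unitary_repD(3,4)[OF \<tau>(1)] z by (metis id_apply)
  let ?W = "{v. \<tau> z v = v}"
  have "csubspace ?W"
    using cvec.scale_zero_left clinear_scaleC[OF lin, of 0 0]
    by (intro cvec.subspaceI) (auto simp: clinear_add[OF lin] clinear_scaleC[OF lin])
  moreover have "\<tau> g ` ?W \<subseteq> ?W" if "g \<in> K" for g
  proof clarify
    fix v assume "\<tau> z v = v"
    then show "\<tau> z (\<tau> g v) = \<tau> g v"
      using unitary_repD(4)[OF \<tau>(1) that z(1), of v] unitary_repD(4)[OF \<tau>(1) z(1) that, of v] z(3)[OF that]
      by simp
  qed
  ultimately have "?W = {0} \<or> ?W = UNIV"
    using \<tau>(2) unfolding irreducible_rep_def by blast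
  then show ?thesis
  proof
    assume W: "?W = {0}"
    have "\<tau> z v = (- 1) *\<^sub>C v" for v
    proof -
      have "v + \<tau> z v \<in> ?W" by (simp add: clinear_add[OF lin] sq add.commute)
      then show ?thesis using W by (simp add: scaleC_minus_one eq_neg_iff_add_eq_0 add.commute)
    qed
    then show ?thesis using that by blast
  next
    assume "?W = UNIV"
    then show ?thesis using that[of 1] by (auto simp: scaleC_one)
  qed
qed

text \<open>
  Up to the factor 2, this computes the trace of the average \<open>A = \<integral> \<chi>\<^sub>\<pi>(k\<^sup>-\<^sup>1) \<pi>(k) dk\<close>: it is the
  nonnegative number \<open>d(\<pi>) \<integral> |\<xi>\<^sub>\<pi>|\<^sup>2\<close>, as \<open>\<chi>\<^sub>\<pi>(k\<^sup>-\<^sup>1)\<close> is the conjugate of \<open>\<chi>\<^sub>\<pi>(k)\<close>.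
\<close>

lemma sum_inner_char_average:
  fixes \<pi> :: "real ^ 'n ^ 'n \<Rightarrow> 'w::hermitian_space \<Rightarrow> 'w"
  assumes \<pi>: "unitary_rep SO_group \<pi>" and \<mu>: "normalized_haar SO_group \<mu>"
  shows "(\<Sum>b\<in>Basis. (LINT k|\<mu>. chi \<pi> (matrix_inv k) *\<^sub>C \<pi> k b) \<bullet> b)
    = (LINT k|\<mu>. 2 * real (cdim (UNIV :: 'w set)) * (cmod (ctrace (\<pi> k)))\<^sup>2)"
proof -
  have int: "integrable \<mu> (\<lambda>k. chi \<pi> (matrix_inv k) *\<^sub>C \<pi> k b)" for b
    by (intro integrable_haar[OF compact_SO_group \<mu>] continuous_on_chi_scaleC \<pi> unitary_repD(5)[OF \<pi>])
  have "(\<Sum>b\<in>Basis. (LINT k|\<mu>. chi \<pi> (matrix_inv k) *\<^sub>C \<pi> k b) \<bullet> b)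
    = (LINT k|\<mu>. (\<Sum>b\<in>Basis. (chi \<pi> (matrix_inv k) *\<^sub>C \<pi> k b) \<bullet> b))"
    by (simp add: int)
  also have "\<dots> = (LINT k|\<mu>. 2 * real (cdim (UNIV :: 'w set)) * (cmod (ctrace (\<pi> k)))\<^sup>2)"
  proof (rule Bochner_Integration.integral_cong[OF refl])
    fix k assume "k \<in> space \<mu>"
    then have k: "k \<in> SO_group" using haar_space[OF \<mu>] by simp
    have "(\<Sum>b\<in>Basis. (chi \<pi> (matrix_inv k) *\<^sub>C \<pi> k b) \<bullet> b)
      = Re (cnj (chi \<pi> k) * (\<Sum>b\<in>Basis. cinner (\<pi> k b) b))"
      by (simp only: chi_inverse[OF \<pi> k] Re_cinner[symmetric] cinner_scaleC_left sum_distrib_left Re_sum)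
    also have "(\<Sum>b\<in>Basis. cinner (\<pi> k b) b) = 2 * ctrace (\<pi> k)"
      by (simp add: ctrace_eq_sum_cinner_Basis[OF unitary_repD(1)[OF \<pi> k]])
    also have "Re (cnj (chi \<pi> k) * (2 * ctrace (\<pi> k)))
      = 2 * real (cdim (UNIV :: 'w set)) * (cmod (ctrace (\<pi> k)))\<^sup>2"
      unfolding cmod_power2 by (simp add: chi_def power2_eq_square algebra_simps)
    finally show "(\<Sum>b\<in>Basis. (chi \<pi> (matrix_inv k) *\<^sub>C \<pi> k b) \<bullet> b)
      = 2 * real (cdim (UNIV :: 'w set)) * (cmod (ctrace (\<pi> k)))\<^sup>2" .
  qed
  finally show ?thesis .
qed

text \<open>
  Through the embedding \<open>T\<close> of \<open>\<pi>\<close> into \<open>\<tau>\<close>, the operator \<open>P\<close> acts on the space of \<open>\<pi>\<close> as the average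
  \<open>A\<close>. If \<open>P\<^sup>2 = - P\<close>, then \<open>- A\<close> is idempotent and has nonnegative trace, whereas the trace of
  \<open>A\<close> is a nonnegative multiple of \<open>\<integral> |\<xi>\<^sub>\<pi>|\<^sup>2\<close>. Hence \<open>\<chi>\<^sub>\<pi>\<close> vanishes almost everywhere,
  and with it the integrand that defines \<open>P\<close>.
\<close>

lemma isotypic_proj_zero_if_square_eq_uminus:
  fixes \<tau> :: "real ^ ('n::finite option) ^ ('n option) \<Rightarrow> 'v::hermitian_space \<Rightarrow> 'v"
    and \<pi> :: "real ^ 'n ^ 'n \<Rightarrow> 'w::hermitian_space \<Rightarrow> 'w"
  assumes \<tau>: "unitary_rep SO_group \<tau>" and \<pi>: "unitary_rep SO_group \<pi>" and sub: "is_subrep SO_group \<pi> \<tau>"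
    and \<mu>: "normalized_haar SO_group \<mu>"
    and sq: "\<And>v. isotypic_proj \<mu> \<tau> \<pi> (isotypic_proj \<mu> \<tau> \<pi> v) = - isotypic_proj \<mu> \<tau> \<pi> v"
  shows "isotypic_proj \<mu> \<tau> \<pi> v = 0"
proof -
  let ?P = "isotypic_proj \<mu> \<tau> \<pi>"
  let ?r = "\<lambda>k. 2 * real (cdim (UNIV :: 'w set)) * (cmod (ctrace (\<pi> k)))\<^sup>2"
  define A where "A w = (LINT k|\<mu>. chi \<pi> (matrix_inv k) *\<^sub>C \<pi> k w)" for w
  have int: "integrable \<mu> (\<lambda>k. chi \<pi> (matrix_inv k) *\<^sub>C \<pi> k w)" for w
    by (intro integrable_haar[OF compact_SO_group \<mu>] continuous_on_chi_scaleC \<pi> unitary_repD(5)[OF \<pi>])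
  have SO: "k \<in> SO_group" if "k \<in> space \<mu>" for k using that haar_space[OF \<mu>] by simp
  obtain T where T: "clinear T" "inj T" "\<And>k w. k \<in> SO_group \<Longrightarrow> T (\<pi> k w) = \<tau> (emb k) (T w)"
    using sub unfolding is_subrep_def by blast
  have PT: "?P (T w) = T (A w)" for w
  proof -
    have "T (A w) = (LINT k|\<mu>. T (chi \<pi> (matrix_inv k) *\<^sub>C \<pi> k w))"
      unfolding A_def by (rule integral_bounded_linear[OF clinear_bounded_linear[OF T(1)] int, symmetric])
    also have "\<dots> = ?P (T w)"
      unfolding isotypic_proj_def using SO
      by (intro Bochner_Integration.integral_cong) (auto simp: clinear_scaleC[OF T(1)] T(3))
    finally show ?thesis ..
  qed
  have "T (A (A w)) = T (- A w)" for w
    using sq[of "T w"] by (simp add: PT clinear_minus[OF T(1)])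
  then have AA: "A (A w) = - A w" for w using T(2) by (simp add: inj_eq)
  have "clinear A"
  proof (rule clinearI)
    fix x y show "A (x + y) = A x + A y"
      unfolding A_def using SO
      by (subst Bochner_Integration.integral_add[OF int int, symmetric])
        (auto intro!: Bochner_Integration.integral_cong
          simp: clinear_add[OF unitary_repD(1)[OF \<pi>]] scaleC_add_right)
  next
    fix c x show "A (c *\<^sub>C x) = c *\<^sub>C A x"
      unfolding A_def using SO
      by (subst integral_bounded_linear[OF clinear_bounded_linear[OF clinear_scaleC_right] int, symmetric])
        (auto intro!: Bochner_Integration.integral_cong
          simp: clinear_scaleC[OF unitary_repD(1)[OF \<pi>]] scaleC_scaleC mult.commute)
  qed
  then have "clinear (\<lambda>w. - A w)"
    using cvec.scale_minus_right by (intro clinearI) (auto simp: clinear_add clinear_scaleC)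
  moreover have "- A (- A w) = - A w" for w
    by (simp add: clinear_minus[OF \<open>clinear A\<close>] AA)
  ultimately have "0 \<le> (\<Sum>b\<in>Basis. (- A b) \<bullet> b)" by (intro trace_idempotent_nonneg)
  then have "(\<Sum>b\<in>Basis. A b \<bullet> b) \<le> 0" by (simp add: sum_negf)
  then have "(LINT k|\<mu>. ?r k) \<le> 0"
    unfolding A_def sum_inner_char_average[OF \<pi> \<mu>] .
  moreover have "integrable \<mu> ?r"
    by (intro integrable_haar[OF compact_SO_group \<mu>] continuous_intros continuous_on_ctrace \<pi>)
  moreover have "0 \<le> (LINT k|\<mu>. ?r k)" by (intro integral_nonneg_AE) simp
  ultimately have "integrable \<mu> ?r" "(LINT k|\<mu>. ?r k) = 0" by (simp_all only: order_antisym)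
  moreover have "AE k in \<mu>. 0 \<le> ?r k" by simp
  ultimately have "AE k in \<mu>. ?r k = 0"
    using integral_nonneg_eq_0_iff_AE by blast
  moreover have "chi \<pi> (matrix_inv k) = 0" if "k \<in> space \<mu>" "?r k = 0" for k
    unfolding chi_inverse[OF \<pi> SO[OF that(1)]] using that(2) by (auto simp: chi_def)
  ultimately have "AE k in \<mu>. chi \<pi> (matrix_inv k) *\<^sub>C \<tau> (emb k) v = 0"
    by (elim AE_mp) (intro AE_I2 impI, simp only: cvec.scale_zero_left)
  then show ?thesis unfolding isotypic_proj_def by (rule integral_eq_zero_AE)
qed

section \<open>Equality of the spherical functions\<close>

text \<open>
  Both cases of the theorem at once, with \<open>s = \<psi>(- 1)\<close> the sign prescribed for \<open>\<Phi>(- I)\<close>. Spherical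
  functions are built from the projections alone, so equality of the two projections suffices.
\<close>

lemma same_spherical_function_tensor_char:
  fixes \<tau> :: "real ^ ('n::finite option) ^ ('n option) \<Rightarrow> 'v::hermitian_space \<Rightarrow> 'v"
    and \<pi> :: "real ^ 'n ^ 'n \<Rightarrow> 'w::hermitian_space \<Rightarrow> 'w"
  assumes odd: "odd CARD('n)"
    and \<tau>: "unitary_rep SO_group \<tau>" "irreducible_rep SO_group \<tau>" and \<pi>: "unitary_rep SO_group \<pi>"
    and sub: "is_subrep SO_group \<pi> \<tau>"
    and \<mu>: "normalized_haar SO_group \<mu>" and \<nu>: "normalized_haar O_group \<nu>"
    and \<psi>: "\<psi> (mat 1) = 1" "\<psi> (- mat 1) = s" and s: "s = 1 \<or> s = - 1"
    and eq: "spherical_function \<mu> \<tau> \<pi> (- mat 1) = (\<lambda>v\<in>isotypic \<mu> \<tau> \<pi>. s *\<^sub>C v)"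
  shows "same_spherical_function \<mu> \<nu> \<tau> \<pi> (tensor_char \<pi> \<psi>)"
proof -
  let ?P = "isotypic_proj \<mu> \<tau> \<pi>" and ?a = "- mat 1 :: real ^ 'n option ^ 'n option"
  have a: "?a \<in> SO_group"
    using odd by (intro uminus_one_in_SO_group) simp
  obtain \<sigma> where \<sigma>: "\<sigma> = 1 \<or> \<sigma> = - 1" "\<And>v. \<tau> ?a v = \<sigma> *\<^sub>C v"
    using central_involution_scalar[OF \<tau> a]
    by (auto simp: matrix_mul_uminus_left matrix_mul_uminus_right)
  have P_minus: "?P (- v) = - ?P v" for v
  proof -
    have "?P (- v) = (LINT k|\<mu>. - (chi \<pi> (matrix_inv k) *\<^sub>C \<tau> (emb k) v))"
      unfolding isotypic_proj_def
    proof (rule Bochner_Integration.integral_cong[OF refl])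
      fix k assume "k \<in> space \<mu>"
      then have "emb k \<in> SO_group" using haar_space[OF \<mu>] emb_in_SO_group by (auto simp: SO_group_iff[of k])
      then show "chi \<pi> (matrix_inv k) *\<^sub>C \<tau> (emb k) (- v) = - (chi \<pi> (matrix_inv k) *\<^sub>C \<tau> (emb k) v)"
        by (simp add: clinear_minus[OF unitary_repD(1)[OF \<tau>(1)]] cvec.scale_minus_right)
    qed
    then show ?thesis by (simp add: isotypic_proj_def)
  qed
  \<comment> \<open>the hypothesis on \<open>\<Phi>(- I)\<close>, evaluated at the elements \<open>P v\<close> of the isotypic subspace\<close>
  have P_sq: "\<sigma> *\<^sub>C ?P (?P v) = s *\<^sub>C ?P v" for v
  proof -
    have "?P v \<in> isotypic \<mu> \<tau> \<pi>" by (simp add: isotypic_def)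
    then have "?P (\<tau> ?a (?P v)) = s *\<^sub>C ?P v"
      using fun_cong[OF eq, of "?P v"] by (simp add: spherical_function_def)
    then show ?thesis using \<sigma>(1) by (auto simp: \<sigma>(2) scaleC_one scaleC_minus_one P_minus)
  qed
  note P_\<gamma> = isotypic_proj_tensor_char[where \<mu> = \<mu> and \<psi> = \<psi>, OF odd \<tau>(1) \<pi> \<mu> \<nu> \<psi>(1)]
  have half: "(1/2) *\<^sub>R (x + x) = x" for x :: 'v by (simp flip: scaleR_2)
  have "isotypic_proj \<nu> \<tau> (tensor_char \<pi> \<psi>) v = ?P v" for v
  proof (cases "\<sigma> = s")
    case True
    then have "s *\<^sub>C ?P (\<tau> ?a v) = ?P v"
      using s by (auto simp: \<sigma>(2) scaleC_one scaleC_minus_one P_minus)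
    then show ?thesis
      by (simp add: P_\<gamma> \<psi>(2) half)
  next
    case False
    then have "?P (?P u) = - ?P u" for u
      using P_sq[of u] s \<sigma>(1) by (auto simp: scaleC_one scaleC_minus_one minus_equation_iff)
    then have "?P u = 0" for u
      by (rule isotypic_proj_zero_if_square_eq_uminus[OF \<tau>(1) \<pi> sub \<mu>])
    then show ?thesis
      by (simp add: P_\<gamma>)
  qed
  then have "isotypic_proj \<nu> \<tau> (tensor_char \<pi> \<psi>) = ?P" by (rule ext)
  then show ?thesis
    by (simp add: same_spherical_function_def isotypic_def spherical_function_def)
qed

theorem theorem3p1:
  fixes \<tau> :: "real ^ ('n::finite option) ^ ('n option) \<Rightarrow> 'v::hermitian_space \<Rightarrow> 'v"
    and \<pi> :: "real ^ 'n ^ 'n \<Rightarrow> 'w::hermitian_space \<Rightarrow> 'w"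
    and \<mu> \<nu> :: "(real ^ 'n ^ 'n) measure"
  assumes "odd CARD('n)"
    and "unitary_rep SO_group \<tau>" and "irreducible_rep SO_group \<tau>"
    and "unitary_rep SO_group \<pi>" and "irreducible_rep SO_group \<pi>"
    and "is_subrep SO_group \<pi> \<tau>"
    and "normalized_haar SO_group \<mu>" and "normalized_haar O_group \<nu>"
  shows "(spherical_function \<mu> \<tau> \<pi> (- mat 1) = (\<lambda>v\<in>isotypic \<mu> \<tau> \<pi>. v)
            \<longrightarrow> same_spherical_function \<mu> \<nu> \<tau> \<pi> (tensor_char \<pi> triv_char)) \<and>
         (spherical_function \<mu> \<tau> \<pi> (- mat 1) = (\<lambda>v\<in>isotypic \<mu> \<tau> \<pi>. - v)
            \<longrightarrow> same_spherical_function \<mu> \<nu> \<tau> \<pi> (tensor_char \<pi> eps_char))"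
proof -
  have "mat 1 $ i $ i \<noteq> (- mat 1 :: real ^ 'n ^ 'n) $ i $ i" for i :: 'n
    by (simp add: mat_def)
  then have ne: "(mat 1 :: real ^ 'n ^ 'n) \<noteq> - mat 1" by metis
  note * = same_spherical_function_tensor_char[OF assms(1-4,6-8)]
  show ?thesis
    using *[of triv_char 1] *[of eps_char "- 1"] ne
    by (simp add: triv_char_def eps_char_def scaleC_one scaleC_minus_one)
qed

end
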